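(* A set of gcd conditions $(\mathcal{Q},f)$ is admissible if and only if for every prime $p$ and every element $T \in \mathcal{Q}$, $g_p(T) = \min \{ v_i^{(p)} \mid i \in T \}$.
   Context: Let $k \geq 2$ be an integer and $S = \{1,2,\dots,k\}$. Let $\mathcal{Q}$ be a collection of subsets of $S$, each having at least $2$ elements, and let $f: \mathcal{Q} \to \mathbb{N}$ (here $\mathbb{N}$ denotes the positive integers). The pair $(\mathcal{Q},f)$ is called a set of gcd conditions: a tuple $(n_1,\dots,n_k) \in \mathbb{N}^k$ satisfies it if $f(T) = \gcd\{ n_i \mid i \in T \}$ for every $T \in \mathcal{Q}$. The set of gcd conditions $(\mathcal{Q},f)$ is admissible if there exists at least one tuple in $\mathbb{N}^k$ satisfying all these conditions. For a prime $p$ and $T \in \mathcal{Q}$, let $g_p(T) := \operatorname{ord}_p(f(T))$ be the exponent of $p$ in $f(T)$. For each $i \in S$ and prime $p$, define $v_i^{(p)} := \max\left( \{0\} \cup \{ g_p(T) \mid T \in \mathcal{Q},\ i \in T \} \right)$. *)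

theory Defs
  imports "HOL-Computational_Algebra.Primes" "HOL-Library.FuncSet"
begin

text \<open>
  The positive integers are the positive elements of \<^typ>\<open>nat\<close>. Only the values of
  \<open>f\<close> on members of \<open>Q\<close> matter.
\<close>

definition gcd_conditions :: "nat \<Rightarrow> nat set set \<Rightarrow> (nat set \<Rightarrow> nat) \<Rightarrow> bool" where
  "gcd_conditions k Q f \<longleftrightarrow>
     (\<forall>T\<in>Q. T \<subseteq> {1..k} \<and> card T \<ge> 2) \<and> (\<forall>T\<in>Q. f T > 0)"

definition satisfies :: "(nat \<Rightarrow> nat) \<Rightarrow> nat set set \<Rightarrow> (nat set \<Rightarrow> nat) \<Rightarrow> bool" where
  "satisfies n Q f \<longleftrightarrow> (\<forall>T\<in>Q. f T = Gcd {n i | i. i \<in> T})"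

definition admissible :: "nat \<Rightarrow> nat set set \<Rightarrow> (nat set \<Rightarrow> nat) \<Rightarrow> bool" where
  "admissible k Q f \<longleftrightarrow> (\<exists>n \<in> {1..k} \<rightarrow>\<^sub>E {0<..}. satisfies n Q f)"

definition g :: "(nat set \<Rightarrow> nat) \<Rightarrow> nat \<Rightarrow> nat set \<Rightarrow> nat" where
  "g f p T = multiplicity p (f T)"

definition v :: "nat set set \<Rightarrow> (nat set \<Rightarrow> nat) \<Rightarrow> nat \<Rightarrow> nat \<Rightarrow> nat" where
  "v Q f p i = Max ({0} \<union> {g f p T | T. T \<in> Q \<and> i \<in> T})"

end

theory Submission
  imports Defs
begin

text \<open>
  Taking p-adic valuations turns gcd into minimum and lcm into maximum. If a tuple satisfies the
  conditions, then \<open>v Q f p i\<close> lies between \<open>g f p T\<close> and the valuation of \<open>n i\<close> for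
  all \<open>i \<in> T\<close>, and the latter equals \<open>g f p T\<close> for some \<open>i \<in> T\<close>. Conversely,
  the numbers \<open>n i = lcm {f T | i \<in> T \<in> Q}\<close> have valuations exactly \<open>v Q f p i\<close>, so they
  satisfy the conditions as soon as the valuations match.
\<close>

text \<open>Induction from the binary gcd. Zero is excluded because \<open>multiplicity p 0\<close>
  is 0 by convention, whereas 0 is neutral for gcd.\<close>

lemma multiplicity_Gcd_nat:
  fixes A :: "nat set"
  assumes "prime p" "finite A" "A \<noteq> {}" "0 \<notin> A"
  shows "multiplicity p (Gcd A) = Min (multiplicity p ` A)"
  using assms(2-)
proof (induction A rule: finite_ne_induct)
  case (insert x A)
  then have "Gcd A \<noteq> 0"
    by auto
  with insert assms(1) show ?case
    by (simp add: multiplicity_gcd)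
qed simp

text \<open>The inserted 0 covers the empty set, whose \<open>Lcm\<close> is 1.\<close>

lemma multiplicity_Lcm_nat:
  fixes A :: "nat set"
  assumes "prime p" "finite A" "0 \<notin> A"
  shows "multiplicity p (Lcm A) = Max (insert 0 (multiplicity p ` A))"
  using assms(2-)
proof (induction A rule: finite_induct)
  case (insert x A)
  then have "Lcm A \<noteq> 0"
    by (auto simp: Lcm_0_iff)
  with insert assms(1) show ?case
    by (simp add: multiplicity_lcm insert_commute[of 0])
qed simp

lemma g_le_v:
  assumes "finite Q" "T \<in> Q" "i \<in> T"
  shows "g f p T \<le> v Q f p i"
  unfolding v_def using assms by (intro Max_ge) auto

lemma v_le:
  assumes "finite Q" "\<And>T. T \<in> Q \<Longrightarrow> i \<in> T \<Longrightarrow> g f p T \<le> m"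
  shows "v Q f p i \<le> m"
  unfolding v_def using assms by (subst Max_le_iff) auto

text \<open>The default 0 in \<open>v\<close> matches the empty lcm 1, so an index lying in no
  member of \<open>Q\<close> fits as well.\<close>

lemma v_eq_multiplicity_Lcm:
  assumes "prime p" "finite Q" "\<forall>T\<in>Q. f T > 0"
  shows "v Q f p i = multiplicity p (Lcm (f ` {T \<in> Q. i \<in> T}))"
proof -
  have "{0} \<union> {g f p T | T. T \<in> Q \<and> i \<in> T}
      = insert 0 (multiplicity p ` f ` {T \<in> Q. i \<in> T})"
    by (auto simp: g_def)
  with assms show ?thesis
    by (subst multiplicity_Lcm_nat) (auto simp: v_def)
qed

theorem theorem1:
  fixes k :: nat and Q :: "nat set set" and f :: "nat set \<Rightarrow> nat"
  assumes "k \<ge> 2"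
    and "gcd_conditions k Q f"
  shows "admissible k Q f \<longleftrightarrow>
    (\<forall>p. prime p \<longrightarrow> (\<forall>T\<in>Q. g f p T = Min {v Q f p i | i. i \<in> T}))"
proof -
  have T: "T \<subseteq> {1..k}" "finite T" "T \<noteq> {}" if "T \<in> Q" for T
    using assms(2) that finite_subset[of T "{1..k}"] by (fastforce simp: gcd_conditions_def)+
  have fpos: "\<forall>T\<in>Q. f T > 0"
    using assms(2) by (simp add: gcd_conditions_def)
  have "Q \<subseteq> Pow {1..k}"
    using T(1) by blast
  then have finQ: "finite Q"
    by (rule finite_subset) simp
  have multG: "multiplicity p (Gcd {n i | i. i \<in> T}) = Min ((\<lambda>i. multiplicity p (n i)) ` T)"
    if "prime p" "T \<in> Q" "\<forall>i\<in>{1..k}. n i > 0" for p :: nat and n T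
  proof -
    have "{n i | i. i \<in> T} = n ` T"
      by auto
    moreover have "0 \<notin> n ` T"
      using T(1)[OF that(2)] that(3) by fastforce
    ultimately show ?thesis
      using that T[OF that(2)] by (simp add: multiplicity_Gcd_nat image_image)
  qed
  show ?thesis
  proof (intro iffI allI impI ballI)
    fix p :: nat and T
    assume "admissible k Q f" and p: "prime p" and TQ: "T \<in> Q"
    then obtain n where n: "\<forall>i\<in>{1..k}. n i > 0" and sat: "satisfies n Q f"
      by (auto simp: admissible_def)
    have gMin: "g f p U = Min ((\<lambda>i. multiplicity p (n i)) ` U)" if "U \<in> Q" for U
      using sat multG[OF p that n] that by (simp add: g_def satisfies_def)
    \<comment> \<open>For each \<open>U\<close> in \<open>Q\<close> containing \<open>i\<close>,
      \<open>gMin\<close> makes \<open>g f p U\<close> a minimum in which \<open>n i\<close> takes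
      part.\<close>
    have v_le_mult: "v Q f p i \<le> multiplicity p (n i)" for i
      using finQ T(2) by (intro v_le) (auto simp: gMin intro!: Min_le)
    have "g f p T \<in> (\<lambda>i. multiplicity p (n i)) ` T"
      unfolding gMin[OF TQ] using T[OF TQ] by (intro Min_in) auto
    then obtain i where i: "i \<in> T" "g f p T = multiplicity p (n i)"
      by blast
    \<comment> \<open>At this \<open>i\<close> the upper bound for \<open>v\<close> equals the lower
      bound \<open>g f p T\<close>.\<close>
    with v_le_mult[of i] g_le_v[OF finQ TQ, of i f p] have "g f p T = v Q f p i"
      by simp
    with i(1) have "g f p T \<in> {v Q f p i | i. i \<in> T}"
      by blast
    moreover have "finite {v Q f p i | i. i \<in> T}"
      using T(2)[OF TQ] by simp
    moreover have "g f p T \<le> x" if "x \<in> {v Q f p i | i. i \<in> T}" for x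
      using that g_le_v[OF finQ TQ] by auto
    ultimately show "g f p T = Min {v Q f p i | i. i \<in> T}"
      by (metis (no_types, lifting) Min_eqI)
  next
    assume *: "\<forall>p. prime p \<longrightarrow> (\<forall>T\<in>Q. g f p T = Min {v Q f p i | i. i \<in> T})"
    \<comment> \<open>The restriction to \<open>{1..k}\<close> makes \<open>n\<close> extensional,
      as \<open>\<rightarrow>\<^sub>E\<close> demands.\<close>
    define n where "n = (\<lambda>i\<in>{1..k}. Lcm (f ` {T \<in> Q. i \<in> T}))"
    \<comment> \<open>Finiteness of \<open>Q\<close> matters here: the \<open>Lcm\<close> of an
      infinite set of naturals is 0.\<close>
    have npos: "n i > 0" if "i \<in> {1..k}" for i
      using that finQ fpos by (fastforce simp: n_def Lcm_0_iff intro!: gr0I)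
    have "f T = Gcd {n i | i. i \<in> T}" if TQ: "T \<in> Q" for T
    \<comment> \<open>Positive naturals agree once their valuations agree at every prime.\<close>
    proof (rule multiplicity_eq_nat)
      show "f T > 0"
        using fpos TQ by blast
      obtain j where "j \<in> T" "j \<in> {1..k}"
        using T[OF TQ] by blast
      with npos[of j] show "Gcd {n i | i. i \<in> T} > 0"
        by (fastforce intro!: gr0I)
    next
      fix p :: nat
      assume p: "prime p"
      have "{v Q f p i | i. i \<in> T} = (\<lambda>i. multiplicity p (n i)) ` T"
        using T(1)[OF TQ] v_eq_multiplicity_Lcm[OF p finQ fpos] by (force simp: n_def)
      with * p TQ npos show "multiplicity p (f T) = multiplicity p (Gcd {n i | i. i \<in> T})"
        by (simp add: multG g_def)
    qed
    then have "satisfies n Q f"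
      by (simp add: satisfies_def)
    moreover have "n \<in> {1..k} \<rightarrow>\<^sub>E {0<..}"
      using npos by (auto simp: PiE_iff) (simp add: n_def)
    ultimately show "admissible k Q f"
      unfolding admissible_def by blast
  qed
qed

end
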